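(* The family $\mathscr D^{\infty}_{aqp}(\infty)$ of algebraically $\infty$-quasiperiodic sets at infinity and the family $\mathscr D^{\infty}_{tqp}(\infty)$ of transcendentally $\infty$-quasiperiodic sets at infinity are both infinite.
   Context: A finite set of real numbers is rationally (resp. algebraically) independent if it is linearly independent over the field $\mathbb{Q}$ of rational numbers (resp. over the field of real algebraic numbers). A sequence $(T_i)_{i\ge1}$ of real numbers is rationally (resp. algebraically) independent if each of its finite subsets is; otherwise it is rationally (resp. algebraically) dependent. A function $G\colon\mathbb{R}\to\mathbb{R}$ is $\infty$-quasiperiodic if $G(\tau)=H(\tau,\tau,\tau,\dots)$ for some $H\colon\ell^\infty(\mathbb{R})\to\mathbb{R}$, $H=H(\tau_1,\tau_2,\dots)$ (with $\ell^\infty(\mathbb{R})$ the space of bounded real sequences) which, for each $k\ge1$, is nonconstant and periodic in its $k$-th component with minimal period $T_k>0$, where the sequence of quasiperiods $(T_k)_{k\ge1}$ is rationally independent. $G$ is transcendentally $\infty$-quasiperiodic if $(T_k)_{k\ge1}$ is moreover algebraically independent, and algebraically $\infty$-quasiperiodic if $(T_k)_{k\ge1}$ is rationally independent but algebraically dependent. For $\Omega\subseteq\mathbb{R}^N$ and $t>0$ let ${}_t\Omega:=B_t(0)^c\cap\Omega$, where $B_t(0)$ is the open Euclidean ball of radius $t$ centered at $0$, and let $|\cdot|$ be $N$-dimensional Lebesgue measure. A Lebesgue measurable set $\Omega\subseteq\mathbb{R}^N$ of finite Lebesgue measure is (transcendentally, resp. algebraically) $\infty$-quasiperiodic at infinity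 if there are a constant $D\in(-\infty,-N]$ and a nonnegative function $G\colon\mathbb{R}\to\mathbb{R}$ with $0<\liminf_{\tau\to+\infty}G(\tau)\le\limsup_{\tau\to+\infty}G(\tau)<+\infty$ such that $$|{}_t\Omega|=t^{N+D}\bigl(G(\log t)+o(1)\bigr)\quad\text{as }t\to+\infty$$ and $G$ is (transcendentally, resp. algebraically) $\infty$-quasiperiodic. *)

theory Defs
  imports "HOL-Analysis.Analysis" "HOL-Library.Landau_Symbols"
begin

definition lin_indep_over :: "real set \<Rightarrow> real set \<Rightarrow> bool" where
  "lin_indep_over F S \<longleftrightarrow>
     (\<forall>c. (\<forall>x\<in>S. c x \<in> F) \<longrightarrow> (\<Sum>x\<in>S. c x * x) = 0 \<longrightarrow> (\<forall>x\<in>S. c x = 0))"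

definition rationally_independent_set :: "real set \<Rightarrow> bool" where
  "rationally_independent_set S \<longleftrightarrow> finite S \<and> lin_indep_over \<rat> S"

definition algebraically_independent_set :: "real set \<Rightarrow> bool" where
  "algebraically_independent_set S \<longleftrightarrow> finite S \<and> lin_indep_over {a. algebraic a} S"

text \<open>
  A sequence is a family, so a repeated term is a linear dependence; injectivity accounts for
  this, because the finite subsets of the range do not see repetitions.
  Sequences are indexed from 0.
\<close>

definition rationally_independent :: "(nat \<Rightarrow> real) \<Rightarrow> bool" where
  "rationally_independent T \<longleftrightarrow>
     inj T \<and> (\<forall>S. finite S \<and> S \<subseteq> range T \<longrightarrow> rationally_independent_set S)"

definition algebraically_independent :: "(nat \<Rightarrow> real) \<Rightarrow> bool" where
  "algebraically_independent T \<longleftrightarrow>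
     inj T \<and> (\<forall>S. finite S \<and> S \<subseteq> range T \<longrightarrow> algebraically_independent_set S)"

definition linf :: "(nat \<Rightarrow> real) set" where
  "linf = {x. bounded (range x)}"

text \<open>
  A function on \<open>linf\<close> is represented by a function on all sequences whose values outside
  \<open>linf\<close> are never consulted.
\<close>

definition nonconstant_in :: "((nat \<Rightarrow> real) \<Rightarrow> real) \<Rightarrow> nat \<Rightarrow> bool" where
  "nonconstant_in H k \<longleftrightarrow> (\<exists>x\<in>linf. \<exists>s. H (x(k := s)) \<noteq> H x)"

definition periods_in :: "((nat \<Rightarrow> real) \<Rightarrow> real) \<Rightarrow> nat \<Rightarrow> real set" where
  "periods_in H k = {p. p > 0 \<and> (\<forall>x\<in>linf. H (x(k := x k + p)) = H x)}"

definition minimal_period_in :: "((nat \<Rightarrow> real) \<Rightarrow> real) \<Rightarrow> nat \<Rightarrow> real \<Rightarrow> bool" where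
  "minimal_period_in H k p \<longleftrightarrow> p \<in> periods_in H k \<and> (\<forall>q\<in>periods_in H k. p \<le> q)"

definition has_quasiperiods :: "(real \<Rightarrow> real) \<Rightarrow> (nat \<Rightarrow> real) \<Rightarrow> bool" where
  "has_quasiperiods G T \<longleftrightarrow>
     (\<exists>H. (\<forall>\<tau>. G \<tau> = H (\<lambda>_. \<tau>)) \<and>
          (\<forall>k. nonconstant_in H k \<and> minimal_period_in H k (T k))) \<and>
     rationally_independent T"

definition inf_quasiperiodic :: "(real \<Rightarrow> real) \<Rightarrow> bool" where
  "inf_quasiperiodic G \<longleftrightarrow> (\<exists>T. has_quasiperiods G T)"

definition transcendentally_inf_quasiperiodic :: "(real \<Rightarrow> real) \<Rightarrow> bool" where
  "transcendentally_inf_quasiperiodic G \<longleftrightarrow>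
     (\<exists>T. has_quasiperiods G T \<and> algebraically_independent T)"

definition algebraically_inf_quasiperiodic :: "(real \<Rightarrow> real) \<Rightarrow> bool" where
  "algebraically_inf_quasiperiodic G \<longleftrightarrow>
     (\<exists>T. has_quasiperiods G T \<and> \<not> algebraically_independent T)"

definition tail :: "real \<Rightarrow> (real ^ 'n) set \<Rightarrow> (real ^ 'n) set" where
  "tail t \<Omega> = - ball 0 t \<inter> \<Omega>"

text \<open>
  The three notions for sets differ only in the property \<open>Q\<close> demanded of \<open>G\<close>.
\<close>

definition at_infinity_with :: "((real \<Rightarrow> real) \<Rightarrow> bool) \<Rightarrow> (real ^ 'n) set \<Rightarrow> bool" where
  "at_infinity_with Q \<Omega> \<longleftrightarrow>
     \<Omega> \<in> lmeasurable \<and>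
     (\<exists>(D::real) G.
        D \<le> - real CARD('n) \<and>
        (\<forall>\<tau>. 0 \<le> G \<tau>) \<and>
        0 < Liminf at_top (\<lambda>\<tau>. ereal (G \<tau>)) \<and>
        Liminf at_top (\<lambda>\<tau>. ereal (G \<tau>)) \<le> Limsup at_top (\<lambda>\<tau>. ereal (G \<tau>)) \<and>
        Limsup at_top (\<lambda>\<tau>. ereal (G \<tau>)) < \<infinity> \<and>
        (\<exists>r \<in> o[at_top](\<lambda>_. 1). \<forall>\<^sub>F t in at_top.
           measure lebesgue (tail t \<Omega>) = t powr (real CARD('n) + D) * (G (ln t) + r t)) \<and>
        Q G)"

definition inf_quasiperiodic_sets :: "(real ^ 'n) set set" where
  "inf_quasiperiodic_sets = {\<Omega>. at_infinity_with inf_quasiperiodic \<Omega>}"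

definition algebraically_inf_quasiperiodic_sets :: "(real ^ 'n) set set" where
  "algebraically_inf_quasiperiodic_sets =
     {\<Omega>. at_infinity_with algebraically_inf_quasiperiodic \<Omega>}"

definition transcendentally_inf_quasiperiodic_sets :: "(real ^ 'n) set set" where
  "transcendentally_inf_quasiperiodic_sets =
     {\<Omega>. at_infinity_with transcendentally_inf_quasiperiodic \<Omega>}"

end

theory Submission
  imports Defs
begin

text \<open>
  For positive numbers \<open>T\<^sub>k\<close> consider the function \<open>\<Sum>k. 2\<^sup>-\<^sup>k cos (2\<pi> x\<^sub>k / T\<^sub>k)\<close> on sequences. A change of
  the coordinate \<open>x\<^sub>k\<close> affects a single term, so the periods in this coordinate are those of one
  cosine and the minimal one is \<open>T\<^sub>k\<close>. Restriction to constant sequences therefore gives a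
  quasiperiodic function for every rationally independent sequence \<open>T\<close> of positive numbers
  (\<open>has_quasiperiods_cosine_series\<close>). This separates the theorem into an arithmetic question about
  \<open>T\<close> and a geometric question about sets.

  Arithmetic: since a countable field admits only countably many algebraic elements, there is a
  \<open>\<theta> > 1\<close> whose powers are linearly independent over the field of real algebraic numbers. The
  powers of \<open>\<theta>\<close> are the quasiperiods in the transcendental case. In the algebraic case they are
  \<open>\<surd>2, 1, \<theta>, \<theta>\<^sup>2, \<dots>\<close> with \<open>\<theta>\<close> transcendental over the field generated by \<open>\<surd>2\<close>.

  Geometry: let \<open>G\<close> be Lipschitz with constant \<open>L > 0\<close>, bounded, and at least \<open>L\<close> everywhere. Then
  \<open>V t = G (ln t) / t\<close> decreases to \<open>0\<close>: for differentiable \<open>G\<close> its derivative is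
  \<open>(G' (ln t) - G (ln t)) / t\<^sup>2 \<le> 0\<close>. A union of thin shells has exactly the tail volumes \<open>V n\<close> at all
  large integers \<open>n\<close> (\<open>ex_set_with_tail_volumes\<close>), and monotonicity bounds the error between
  consecutive integers by \<open>V n - V (n + 1) = O(n\<^sup>-\<^sup>2)\<close>, which is negligible against \<open>1 / t\<close>. Hence
  the set realises \<open>G\<close> with \<open>D = - N - 1\<close> (\<open>ex_at_infinity_with\<close>). If all \<open>T\<^sub>k\<close> are at least \<open>1\<close>, the
  cosine series on constant sequences is Lipschitz with constant \<open>4\<pi>\<close> and lies between \<open>-2\<close> and \<open>2\<close>, so the
  constant \<open>4\<pi> + 2\<close> lifts it to a function of this kind.

  Finally one set yields infinitely many, because adding a ball around the origin does not change
  the tails for large \<open>t\<close>.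
\<close>

section \<open>Linearly independent sequences of real numbers\<close>

text \<open>
  The sets in the definitions are indexed by their own elements. Injectivity of \<open>T\<close> turns a relation
  on such a set into a relation between initial terms of the sequence, where polynomial arguments
  apply.
\<close>

lemma lin_indep_over_subset_range:
  fixes T :: "nat \<Rightarrow> real"
  assumes "inj T" "0 \<in> F"
    and indep: "\<And>d n. (\<And>k. d k \<in> F) \<Longrightarrow> (\<Sum>k<n. d k * T k) = 0 \<Longrightarrow> \<forall>k<n. d k = 0"
    and "finite S" "S \<subseteq> range T"
  shows "lin_indep_over F S"
  unfolding lin_indep_over_def
proof (intro allI impI)
  fix c assume cF: "\<forall>x\<in>S. c x \<in> F" and sum0: "(\<Sum>x\<in>S. c x * x) = 0"
  define d where "d k = (if T k \<in> S then c (T k) else 0)" for k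
  define K where "K = {k. T k \<in> S}"
  have S: "S = T ` K"
    using \<open>S \<subseteq> range T\<close> by (auto simp: K_def)
  have "finite K"
    using \<open>finite S\<close> S \<open>inj T\<close> by (metis finite_imageD inj_on_subset subset_UNIV)
  then obtain n where n: "K \<subseteq> {..<n}"
    using finite_nat_iff_bounded by blast
  have "(\<Sum>k<n. d k * T k) = (\<Sum>k\<in>K. d k * T k)"
    using n by (intro sum.mono_neutral_right) (auto simp: d_def K_def)
  also have "\<dots> = (\<Sum>k\<in>K. c (T k) * T k)"
    by (intro sum.cong) (auto simp: d_def K_def)
  also have "\<dots> = 0"
    using sum0 unfolding S by (subst (asm) sum.reindex) (use \<open>inj T\<close> in \<open>auto intro: inj_on_subset\<close>)
  finally have "\<forall>k<n. d k = 0"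
    using cF \<open>0 \<in> F\<close> by (intro indep) (auto simp: d_def)
  then have "\<forall>k\<in>K. d k = 0"
    using n by blast
  then show "\<forall>x\<in>S. c x = 0"
    using \<open>S \<subseteq> range T\<close> by (auto simp: d_def K_def)
qed

lemma countable_poly_roots:
  fixes F :: "real set"
  assumes "countable F"
  shows "countable {x. \<exists>p. set (coeffs p) \<subseteq> F \<and> p \<noteq> 0 \<and> poly p x = 0}"
proof -
  have "{p. set (coeffs p) \<subseteq> F} \<subseteq> Poly ` lists F"
    by (smt (verit) Poly_coeffs image_eqI in_lists_conv_set mem_Collect_eq subset_iff)
  then have "countable {p. set (coeffs p) \<subseteq> F}"
    using assms by (meson countable_image countable_lists countable_subset)
  then have "countable (\<Union>p\<in>{p. set (coeffs p) \<subseteq> F}. if p = 0 then {} else {x. poly p x = 0})"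
    by (intro countable_UN) (auto intro: countable_finite poly_roots_finite)
  then show ?thesis
    by (rule countable_subset[rotated]) auto
qed

lemma countable_algebraic: "countable {a::real. algebraic a}"
proof (rule countable_subset[OF _ countable_poly_roots])
  show "countable (\<int> :: real set)"
    by (simp add: Ints_def)
  show "{a::real. algebraic a} \<subseteq> {x. \<exists>p. set (coeffs p) \<subseteq> \<int> \<and> p \<noteq> 0 \<and> poly p x = 0}"
  proof
    fix x :: real assume "x \<in> {a. algebraic a}"
    then obtain p where "\<forall>i. coeff p i \<in> \<int>" "p \<noteq> 0" "poly p x = 0"
      by (auto simp: algebraic_def)
    moreover from this have "set (coeffs p) \<subseteq> \<int>"
      by (auto simp: coeffs_def)
    ultimately show "x \<in> {x. \<exists>p. set (coeffs p) \<subseteq> \<int> \<and> p \<noteq> 0 \<and> poly p x = 0}"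
      by blast
  qed
qed

text \<open>
  Only countably many numbers are roots of the countably many nonzero polynomials over \<open>F\<close>;
  all others have powers that are linearly independent over \<open>F\<close>.
\<close>

lemma ex_powers_independent:
  fixes F :: "real set"
  assumes "countable F"
  shows "\<exists>\<theta>::real>1. \<forall>d n. (\<forall>k<n. d k \<in> F) \<longrightarrow> (\<Sum>k<n. d k * \<theta> ^ k) = 0 \<longrightarrow> (\<forall>k<n. d k = 0)"
proof -
  define R where "R = {x. \<exists>p. set (coeffs p) \<subseteq> insert 0 F \<and> p \<noteq> 0 \<and> poly p x = 0}"
  have "countable R"
    unfolding R_def using assms by (intro countable_poly_roots) auto
  moreover have "uncountable {1<..<2::real}"
    by (simp add: uncountable_open_interval)
  ultimately obtain \<theta> :: real where \<theta>: "\<theta> \<in> {1<..<2}" "\<theta> \<notin> R"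
    by (meson countable_subset subsetI)
  show ?thesis
  proof (intro exI[of _ \<theta>] conjI allI impI)
    show "\<theta> > 1" using \<theta> by simp
  next
    fix d :: "nat \<Rightarrow> real" and n
    assume dF: "\<forall>k<n. d k \<in> F" and sum0: "(\<Sum>k<n. d k * \<theta> ^ k) = 0"
    define p where "p = (\<Sum>k<n. monom (d k) k)"
    have coeff: "coeff p i = (if i < n then d i else 0)" for i
      by (auto simp: p_def coeff_sum)
    have "poly p \<theta> = 0"
      using sum0 by (simp add: p_def poly_sum poly_monom)
    moreover have "set (coeffs p) \<subseteq> insert 0 F"
      using dF by (auto simp: coeffs_def coeff)
    ultimately have "p = 0"
      using \<theta> by (auto simp: R_def)
    then show "d k = 0" if "k < n" for k
      using coeff[of k] that by simp
  qed
qed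

lemma ex_algebraically_independent:
  obtains T :: "nat \<Rightarrow> real" where
    "algebraically_independent T" "rationally_independent T" "\<And>k. T k \<ge> 1"
proof -
  obtain \<theta> :: real where \<theta>: "\<theta> > 1"
    and indep: "\<forall>d n. (\<forall>k<n. d k \<in> {a. algebraic a}) \<longrightarrow>
                   (\<Sum>k<n. d k * \<theta> ^ k) = 0 \<longrightarrow> (\<forall>k<n. d k = 0)"
    using ex_powers_independent[OF countable_algebraic] by blast
  have inj: "inj (\<lambda>k. \<theta> ^ k)"
    using \<theta> by (auto simp: inj_on_def)
  have alg: "lin_indep_over {a. algebraic a} S" if "finite S" "S \<subseteq> range (\<lambda>k. \<theta> ^ k)" for S
  proof (rule lin_indep_over_subset_range[OF inj _ _ that])
    show "\<forall>k<n. d k = 0" if "\<And>k. d k \<in> {a. algebraic a}" "(\<Sum>k<n. d k * \<theta> ^ k) = 0" for d n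
      using indep that by blast
  qed auto
  then have rat: "lin_indep_over \<rat> S" if "finite S" "S \<subseteq> range (\<lambda>k. \<theta> ^ k)" for S
    using that unfolding lin_indep_over_def by (metis mem_Collect_eq rat_imp_algebraic)
  show ?thesis
  proof
    show "algebraically_independent (\<lambda>k. \<theta> ^ k)"
      using inj alg by (auto simp: algebraically_independent_def algebraically_independent_set_def)
    show "rationally_independent (\<lambda>k. \<theta> ^ k)"
      using inj rat by (auto simp: rationally_independent_def rationally_independent_set_def)
    show "\<theta> ^ k \<ge> 1" for k
      using \<theta> by simp
  qed
qed

lemma sqrt_2_not_rational: "sqrt 2 \<notin> \<rat>"
proof
  assume "sqrt 2 \<in> \<rat>"
  moreover have "algebraic_int (sqrt 2)"
    by (intro algebraic_int_sqrt algebraic_int_numeral)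
  ultimately have "sqrt 2 \<in> \<int>"
    by (rule rational_algebraic_int_is_int[rotated])
  then obtain n :: int where n: "sqrt 2 = of_int n"
    by (rule Ints_cases)
  have "1 < sqrt 2" "sqrt 2 < 2"
    using sqrt2_less_2 by simp_all
  then have "1 < n" "n < 2"
    unfolding n by linarith+
  then show False
    by linarith
qed

lemma rat_add_rat_mult_sqrt_2_eq_0:
  assumes "a \<in> \<rat>" "b \<in> \<rat>" "a * sqrt 2 + b = 0"
  shows "a = 0 \<and> b = 0"
proof -
  have "a = 0"
  proof (rule ccontr)
    assume "a \<noteq> 0"
    then have "sqrt 2 = - b / a"
      using assms(3) by (simp add: field_simps)
    moreover have "- b / a \<in> \<rat>"
      using assms by simp
    ultimately show False
      using sqrt_2_not_rational by simp
  qed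
  then show ?thesis
    using assms by simp
qed

text \<open>
  In the sequence \<open>\<surd>2, 1, \<theta>, \<theta>\<^sup>2, \<dots>\<close> the first two terms are dependent over the algebraic numbers.
  A rational dependence becomes a polynomial equation for \<open>\<theta>\<close> over the countable set
  of numbers \<open>a\<surd>2 + b\<close> with rational \<open>a\<close> and \<open>b\<close>, because the first two terms merge into
  the constant coefficient.
\<close>

lemma ex_rationally_not_algebraically_independent:
  obtains T :: "nat \<Rightarrow> real" where
    "\<not> algebraically_independent T" "rationally_independent T" "\<And>k. T k \<ge> 1"
proof -
  define F where "F = (\<lambda>(a, b). a * sqrt 2 + b) ` (\<rat> \<times> \<rat>)"
  have F: "a * sqrt 2 + b \<in> F" if "a \<in> \<rat>" "b \<in> \<rat>" for a b
    using that by (force simp: F_def)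
  have "countable F"
    unfolding F_def by (intro countable_image countable_SIGMA countable_rat)
  then obtain \<theta> :: real where \<theta>: "\<theta> > 1"
    and indep: "\<forall>d n. (\<forall>k<n. d k \<in> F) \<longrightarrow>
                   (\<Sum>k<n. d k * \<theta> ^ k) = 0 \<longrightarrow> (\<forall>k<n. d k = 0)"
    using ex_powers_independent by blast
  define T where "T k = (case k of 0 \<Rightarrow> sqrt 2 | Suc j \<Rightarrow> \<theta> ^ j)" for k
  have T_simps [simp]: "T 0 = sqrt 2" "T (Suc j) = \<theta> ^ j" for j
    by (auto simp: T_def)
  have T_indep: "\<forall>k<n. d k = 0" if d: "\<And>k. d k \<in> \<rat>" and sum0: "(\<Sum>k<n. d k * T k) = 0" for d n
  proof -
    consider "n = 0" | "n = 1" | m where "n = Suc (Suc m)"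
      by (metis One_nat_def not0_implies_Suc)
    then show ?thesis
    proof cases
      case 3
      define e where "e j = (case j of 0 \<Rightarrow> d 0 * sqrt 2 + d 1 | Suc i \<Rightarrow> d (Suc j))" for j
      have "(\<Sum>j<Suc m. e j * \<theta> ^ j) = (\<Sum>k<n. d k * T k)"
        unfolding 3 sum.lessThan_Suc_shift by (simp add: e_def)
      then have "(\<Sum>j<Suc m. e j * \<theta> ^ j) = 0"
        using sum0 by simp
      moreover have "e j \<in> F" for j
        using F[OF d d, of 0 1] F[OF Rats_0 d] by (auto simp: e_def split: nat.split)
      ultimately have e0: "\<forall>j<Suc m. e j = 0"
        using indep by blast
      then have "e 0 = 0"
        by blast
      then have "d 0 = 0 \<and> d 1 = 0"
        using rat_add_rat_mult_sqrt_2_eq_0[OF d d] by (simp add: e_def)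
      moreover have "d (Suc (Suc i)) = 0" if "i < m" for i
        using e0[rule_format, of "Suc i"] that by (simp add: e_def)
      ultimately show ?thesis
        unfolding 3 by (auto simp: less_Suc_eq_0_disj)
    qed (use sum0 in auto)
  qed
  have inj: "inj T"
  proof (rule injI)
    fix j k assume eq: "T j = T k"
    show "j = k"
    proof (rule ccontr)
      assume "j \<noteq> k"
      \<comment> \<open>A repeated term would give the rational relation \<open>T j - T k = 0\<close>.\<close>
      define d where "d i = (if i = j then 1 else if i = k then -1 else 0 :: real)" for i
      have "(\<Sum>i<Suc (max j k). d i * T i) = (\<Sum>i\<in>{j, k}. d i * T i)"
        by (intro sum.mono_neutral_right) (auto simp: d_def)
      also have "\<dots> = 0"
        using eq \<open>j \<noteq> k\<close> by (simp add: d_def)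
      finally have "\<forall>i<Suc (max j k). d i = 0"
        by (intro T_indep) (auto simp: d_def)
      then have "d j = 0"
        by simp
      then show False
        by (simp add: d_def)
    qed
  qed
  show ?thesis
  proof
    have "lin_indep_over \<rat> S" if "finite S" "S \<subseteq> range T" for S
      using T_indep by (intro lin_indep_over_subset_range[OF inj _ _ that]) auto
    then show "rationally_independent T"
      using inj by (auto simp: rationally_independent_def rationally_independent_set_def)
    show "T k \<ge> 1" for k
      using \<theta> by (cases k) auto
    show "\<not> algebraically_independent T"
    proof
      assume "algebraically_independent T"
      moreover have "{T 0, T (Suc 0)} \<subseteq> range T"
        by blast
      ultimately have "algebraically_independent_set {T 0, T (Suc 0)}"
        unfolding algebraically_independent_def by (metis finite.emptyI finite.insertI)
      then have "lin_indep_over {a. algebraic a} {sqrt 2, 1}"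
        by (simp add: algebraically_independent_set_def)
      moreover have "algebraic (- sqrt 2)" "algebraic (1 :: real)"
        by (auto intro!: rat_imp_algebraic[of "1 :: real"] rat_imp_algebraic[of "2 :: real"])
      ultimately show False
        unfolding lin_indep_over_def
        \<comment> \<open>The relation is \<open>1 * \<surd>2 + (- \<surd>2) * 1 = 0\<close>.\<close>
        by (auto dest!: spec[of _ "\<lambda>x. if x = 1 then - sqrt 2 else 1"])
    qed
  qed
qed

section \<open>Quasiperiodic functions with prescribed quasiperiods\<close>

lemma abs_cos_diff_le: "\<bar>cos x - cos y\<bar> \<le> \<bar>x - y\<bar>" for x y :: real
proof -
  have "\<bar>cos x - cos y\<bar> = 2 * \<bar>sin ((x + y) / 2)\<bar> * \<bar>sin ((y - x) / 2)\<bar>"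
    by (simp add: cos_diff_cos abs_mult)
  also have "\<dots> \<le> 2 * 1 * \<bar>(y - x) / 2\<bar>"
    by (intro mult_mono abs_sin_x_le_abs_x) auto
  finally show ?thesis
    by simp
qed

definition cosine_series :: "(nat \<Rightarrow> real) \<Rightarrow> (nat \<Rightarrow> real) \<Rightarrow> real" where
  "cosine_series T x = (\<Sum>k. (1/2) ^ k * cos (2 * pi * x k / T k))"

lemma summable_cosine_series: "summable (\<lambda>k. (1/2) ^ k * cos (2 * pi * x k / T k))"
  for x T :: "nat \<Rightarrow> real"
  by (rule summable_comparison_test[of _ "\<lambda>k. (1/2) ^ k"]) (auto simp: abs_mult)

lemma abs_cosine_series_le: "\<bar>cosine_series T x\<bar> \<le> 2"
proof -
  have "\<bar>cosine_series T x\<bar> \<le> (\<Sum>k. (1/2::real) ^ k)"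
    unfolding cosine_series_def
    by (intro norm_suminf_le[where 'a = real, simplified]) (auto simp: abs_mult)
  then show ?thesis
    by (simp add: suminf_geometric)
qed

lemma cosine_series_update:
  "cosine_series T (x(k := s)) - cosine_series T x =
     (1/2) ^ k * (cos (2 * pi * s / T k) - cos (2 * pi * x k / T k))"
proof -
  let ?f = "\<lambda>x j. (1/2) ^ j * cos (2 * pi * x j / T j)"
  have "cosine_series T (x(k := s)) - cosine_series T x = (\<Sum>j. ?f (x(k := s)) j - ?f x j)"
    unfolding cosine_series_def by (intro suminf_diff summable_cosine_series)
  also have "\<dots> = (\<Sum>j\<in>{k}. ?f (x(k := s)) j - ?f x j)"
    by (intro suminf_finite) auto
  finally show ?thesis
    by (simp add: algebra_simps)
qed

text \<open>
  The \<open>k\<close>-th term has Lipschitz constant \<open>2\<^sup>-\<^sup>k * 2\<pi> / T\<^sub>k\<close>; for \<open>T\<^sub>k \<ge> 1\<close> these constants add up to at most \<open>4\<pi>\<close>.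
\<close>

lemma cosine_series_diagonal_lipschitz:
  assumes "\<And>k. T k \<ge> 1"
  shows "\<bar>cosine_series T (\<lambda>_. x) - cosine_series T (\<lambda>_. y)\<bar> \<le> 4 * pi * \<bar>x - y\<bar>"
proof -
  let ?f = "\<lambda>x k. (1/2) ^ k * cos (2 * pi * x / T k)"
  let ?g = "\<lambda>k. (1/2) ^ k * (2 * pi * \<bar>x - y\<bar>)"
  have g: "?g sums (2 * (2 * pi * \<bar>x - y\<bar>))"
    using geometric_sums[of "1/2::real"] by (intro sums_mult2) simp
  have le: "\<bar>?f x k - ?f y k\<bar> \<le> ?g k" for k
  proof -
    have "\<bar>cos (2 * pi * x / T k) - cos (2 * pi * y / T k)\<bar> \<le> \<bar>2 * pi * x / T k - 2 * pi * y / T k\<bar>"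
      by (rule abs_cos_diff_le)
    also have "\<dots> = 2 * pi * \<bar>x - y\<bar> / T k"
      using assms[of k] by (simp add: abs_mult abs_divide flip: diff_divide_distrib right_diff_distrib)
    also have "\<dots> \<le> 2 * pi * \<bar>x - y\<bar> / 1"
      using assms[of k] by (intro divide_left_mono) auto
    finally show ?thesis
      by (simp add: abs_mult flip: right_diff_distrib)
  qed
  have "\<bar>cosine_series T (\<lambda>_. x) - cosine_series T (\<lambda>_. y)\<bar> = \<bar>\<Sum>k. ?f x k - ?f y k\<bar>"
    unfolding cosine_series_def
    by (subst suminf_diff) (use summable_cosine_series[of "\<lambda>_. x" T] summable_cosine_series[of "\<lambda>_. y" T] in auto)
  also have "\<dots> \<le> (\<Sum>k. ?g k)"
    using le sums_summable[OF g] by (intro norm_suminf_le[where 'a = real, simplified])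
  also have "\<dots> = 4 * pi * \<bar>x - y\<bar>"
    using g by (simp add: sums_iff)
  finally show ?thesis .
qed

text \<open>
  By \<open>cosine_series_update\<close> the behaviour in the \<open>k\<close>-th coordinate is that of a single cosine. The
  sequence \<open>0\<close> suffices to see minimality: there a period \<open>q\<close> gives \<open>cos (2\<pi>q / T\<^sub>k) = 1\<close>.
\<close>

lemma has_quasiperiods_cosine_series:
  assumes "rationally_independent T" and pos: "\<And>k. T k > 0"
  shows "has_quasiperiods (\<lambda>\<tau>. c + cosine_series T (\<lambda>_. \<tau>)) T"
proof -
  define H where "H x = c + cosine_series T x" for x
  have H_eq: "H (x(k := s)) = H x \<longleftrightarrow> cos (2 * pi * s / T k) = cos (2 * pi * x k / T k)" for x k s
    using cosine_series_update[of T x k s] by (auto simp: H_def)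
  have zero: "(\<lambda>_. 0) \<in> linf"
    by (simp add: linf_def)
  have "nonconstant_in H k" for k
  proof -
    have "H ((\<lambda>_. 0)(k := T k / 2)) \<noteq> H (\<lambda>_. 0)"
      using pos[of k] by (simp add: H_eq)
    then show ?thesis
      using zero by (auto simp: nonconstant_in_def)
  qed
  moreover have "minimal_period_in H k (T k)" for k
  proof -
    have "2 * pi * (y + T k) / T k = 2 * pi * y / T k + 2 * pi" for y
      using pos[of k] by (simp add: field_simps)
    then have "T k \<in> periods_in H k"
      using pos[of k] by (simp add: periods_in_def H_eq)
    moreover have "T k \<le> q" if "q \<in> periods_in H k" for q
    proof -
      have "q > 0" "cos (2 * pi * q / T k) = 1"
        using that zero by (force simp: periods_in_def H_eq)+
      then obtain n :: int where n: "2 * pi * q / T k = of_int n * 2 * pi"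
        using cos_one_2pi_int by blast
      then have q: "q = of_int n * T k"
        using pos[of k] by (simp add: field_simps)
      then have "n > 0"
        using \<open>q > 0\<close> pos[of k] by (simp add: zero_less_mult_iff)
      then have "1 * T k \<le> of_int n * T k"
        using pos[of k] by (intro mult_right_mono) auto
      then show ?thesis
        using q by simp
    qed
    ultimately show ?thesis
      by (simp add: minimal_period_in_def)
  qed
  ultimately show ?thesis
    using assms(1) unfolding has_quasiperiods_def by (intro conjI exI[of _ H]) (auto simp: H_def)
qed

section \<open>Sets with prescribed tail volumes\<close>

lemma ex_shell_volume:
  fixes n :: nat
  assumes "0 \<le> a" "a \<le> unit_ball_vol (real CARD('n::finite))"
  obtains \<rho> where "real n \<le> \<rho>" "\<rho> \<le> real (Suc n)"
    "measure lebesgue (ball (0 :: real ^ 'n) \<rho> - ball 0 (real n)) = a"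
proof -
  define \<omega> N where "\<omega> = unit_ball_vol (real CARD('n))" and "N = CARD('n)"
  have "\<omega> > 0" and N: "N > 0"
    by (auto simp: \<omega>_def N_def)
  define \<rho> where "\<rho> = root N (real n ^ N + a / \<omega>)"
  have pow: "\<rho> ^ N = real n ^ N + a / \<omega>"
    unfolding \<rho>_def using N assms(1) \<open>\<omega> > 0\<close> by (intro real_root_pow_pos2) auto
  have \<rho>0: "\<rho> \<ge> 0"
    unfolding \<rho>_def using N assms(1) \<open>\<omega> > 0\<close> by auto
  have "real n ^ N \<le> \<rho> ^ N"
    unfolding pow using assms(1) \<open>\<omega> > 0\<close> by simp
  then have lower: "real n \<le> \<rho>"
    using N \<rho>0 by (simp add: power_mono_iff)
  have "real n ^ N + 1 \<le> real (Suc n) ^ N"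
  proof -
    have "n ^ N < Suc n ^ N"
      using N by (intro power_strict_mono) auto
    then have "real (n ^ N + 1) \<le> real (Suc n ^ N)"
      by (simp only: of_nat_le_iff)
    then show ?thesis
      by simp
  qed
  moreover have "a / \<omega> \<le> 1"
    using assms(2) \<open>\<omega> > 0\<close> by (simp add: \<omega>_def)
  ultimately have "\<rho> ^ N \<le> real (Suc n) ^ N"
    unfolding pow by linarith
  then have upper: "\<rho> \<le> real (Suc n)"
    using N \<rho>0 power_mono_iff[of \<rho> "real (Suc n)" N] by simp
  have vol: "measure lebesgue (ball (0 :: real ^ 'n) r) = \<omega> * r ^ N" if "r \<ge> 0" for r
    using content_ball[OF that, of "0 :: real ^ 'n"] by (simp add: \<omega>_def N_def)
  have "measure lebesgue (ball (0 :: real ^ 'n) \<rho> - ball 0 (real n)) =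
        measure lebesgue (ball (0 :: real ^ 'n) \<rho>) - measure lebesgue (ball (0 :: real ^ 'n) (real n))"
    using lower by (intro measurable_measure_Diff) (auto simp: ball_subset_ball_iff)
  also have "\<dots> = a"
    unfolding vol[OF \<rho>0] vol[OF of_nat_0_le_iff] pow
    using \<open>\<omega> > 0\<close> by (simp add: algebra_simps)
  finally show ?thesis
    using that lower upper by blast
qed

text \<open>
  The shell between the radii \<open>n\<close> and \<open>n + 1\<close> has volume at least that of the unit ball, so it
  has room for a thinner shell of volume \<open>V n - V (n + 1)\<close>. The union of these shells has the
  tail volumes \<open>V n\<close> by telescoping.
\<close>

lemma ex_set_with_tail_volumes:
  fixes V :: "nat \<Rightarrow> real"
  assumes "decseq V" and lim: "V \<longlonglongrightarrow> 0"
    and small: "\<And>n. V n - V (Suc n) \<le> unit_ball_vol (real CARD('n::finite))"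
  obtains \<Omega> :: "(real ^ 'n) set" where
    "\<Omega> \<in> lmeasurable" "\<And>n. measure lebesgue (tail (real n) \<Omega>) = V n"
proof -
  have nonneg: "V n - V (Suc n) \<ge> 0" for n
    using \<open>decseq V\<close> by (simp add: decseq_Suc_iff)
  have "\<exists>\<rho>. real n \<le> \<rho> \<and> \<rho> \<le> real (Suc n) \<and>
            measure lebesgue (ball (0 :: real ^ 'n) \<rho> - ball 0 (real n)) = V n - V (Suc n)" for n
    using ex_shell_volume[OF nonneg small] by metis
  then obtain \<rho> where \<rho>: "\<And>n. real n \<le> \<rho> n" "\<And>n. \<rho> n \<le> real (Suc n)"
      "\<And>n. measure lebesgue (ball (0 :: real ^ 'n) (\<rho> n) - ball 0 (real n)) = V n - V (Suc n)"
    by metis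
  define A where "A n = ball (0 :: real ^ 'n) (\<rho> n) - ball 0 (real n)" for n
  define \<Omega> where "\<Omega> = (\<Union>n. A n)"
  have A_iff: "x \<in> A n \<longleftrightarrow> real n \<le> norm x \<and> norm x < \<rho> n" for x n
    by (auto simp: A_def)
  have A_meas: "A n \<in> lmeasurable" for n
    by (auto simp: A_def intro: fmeasurable.Diff)
  have A_floor: "nat \<lfloor>norm x\<rfloor> = n" if "x \<in> A n" for x n
    using that \<rho>(2)[of n] unfolding A_iff by linarith
  have "tail (real n) \<Omega> = (\<Union>i. A (i + n))" for n
  proof -
    have "(\<exists>i. x \<in> A (i + n)) \<longleftrightarrow> (\<exists>k. x \<in> A k) \<and> real n \<le> norm x" for x
    proof
      assume "\<exists>i. x \<in> A (i + n)"
      then obtain i where "x \<in> A (i + n)"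
        by blast
      moreover from this have "real n \<le> norm x"
        by (simp add: A_iff)
      ultimately show "(\<exists>k. x \<in> A k) \<and> real n \<le> norm x"
        by blast
    next
      assume "(\<exists>k. x \<in> A k) \<and> real n \<le> norm x"
      then obtain k where k: "x \<in> A k" "real n \<le> norm x"
        by blast
      then have "n \<le> k"
        using A_floor[OF k(1)] by linarith
      then show "\<exists>i. x \<in> A (i + n)"
        using k by (metis le_add_diff_inverse2)
    qed
    then show ?thesis
      by (simp add: set_eq_iff tail_def \<Omega>_def not_less conj_commute)
  qed
  moreover have emeas: "emeasure lebesgue (\<Union>i. A (i + n)) = ennreal (V n)" for n
  proof -
    have "disjoint_family (\<lambda>i. A (i + n))"
      unfolding disjoint_family_on_def by (auto dest!: A_floor)
    then have "emeasure lebesgue (\<Union>i. A (i + n)) = (\<Sum>i. emeasure lebesgue (A (i + n)))"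
      using A_meas by (intro suminf_emeasure[symmetric]) (auto intro: fmeasurableD)
    also have "\<dots> = (\<Sum>i. ennreal (V (i + n) - V (Suc (i + n))))"
      by (simp only: emeasure_eq_measure2[OF A_meas] \<rho>(3)[folded A_def])
    also have "\<dots> = ennreal (V n)"
    proof (rule suminf_ennreal_eq)
      show "0 \<le> V (i + n) - V (Suc (i + n))" for i
        by (rule nonneg)
      show "(\<lambda>i. V (i + n) - V (Suc (i + n))) sums V n"
        using telescope_sums'[OF LIMSEQ_ignore_initial_segment[OF lim, of n]] by simp
    qed
    finally show ?thesis .
  qed
  moreover have "V n \<ge> 0" for n
    using \<open>decseq V\<close> lim by (rule decseq_ge)
  ultimately have "measure lebesgue (tail (real n) \<Omega>) = V n" for n
    by (simp add: measure_def)
  moreover have "\<Omega> \<in> lmeasurable"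
  proof (rule fmeasurableI)
    show "\<Omega> \<in> sets lebesgue"
      unfolding \<Omega>_def using A_meas by (auto intro: fmeasurableD)
    show "emeasure lebesgue \<Omega> < \<infinity>"
      using emeas[of 0] by (simp add: \<Omega>_def)
  qed
  ultimately show ?thesis
    using that by blast
qed

text \<open>
  For the quotient to grow from \<open>s\<close> to \<open>t\<close>, the numerator would have to gain more than
  \<open>G (ln s) (t - s) / s\<close>. Its gain is at most \<open>L (ln t - ln s) \<le> L (t - s) / s\<close>, and \<open>L \<le> G (ln s)\<close>.
\<close>

lemma log_rescaled_decay_diff:
  fixes G :: "real \<Rightarrow> real"
  assumes lip: "\<And>x y. \<bar>G x - G y\<bar> \<le> L * \<bar>x - y\<bar>"
    and "L \<le> G (ln s)" "G (ln s) \<le> C" "0 < s" "s \<le> t" "0 \<le> L"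
  shows "G (ln t) / t \<le> G (ln s) / s"
    and "G (ln s) / s - G (ln t) / t \<le> (C + L) * (t - s) / (s * t)"
proof -
  have "ln t - ln s \<le> (t - s) / s"
    using ln_le_minus_one[of "t / s"] assms by (simp add: ln_div diff_divide_distrib)
  then have "L * (ln t - ln s) \<le> L * ((t - s) / s)"
    using \<open>0 \<le> L\<close> by (intro mult_left_mono)
  moreover have "\<bar>G (ln t) - G (ln s)\<bar> \<le> L * (ln t - ln s)"
    using lip[of "ln t" "ln s"] assms by simp
  ultimately have close: "\<bar>G (ln t) - G (ln s)\<bar> \<le> L * ((t - s) / s)"
    by linarith
  have "L * ((t - s) / s) \<le> G (ln s) * ((t - s) / s)"
    using assms by (intro mult_right_mono) auto
  with close have "G (ln t) \<le> G (ln s) + G (ln s) * ((t - s) / s)"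
    by linarith
  then show "G (ln t) / t \<le> G (ln s) / s"
    using assms by (simp add: field_simps)
  have "G (ln s) * ((t - s) / s) \<le> C * ((t - s) / s)"
    using assms by (intro mult_right_mono) auto
  with close have "G (ln s) * ((t - s) / s) + (G (ln s) - G (ln t)) \<le> (C + L) * ((t - s) / s)"
    unfolding distrib_right[of C L] by linarith
  then have "(G (ln s) * ((t - s) / s) + (G (ln s) - G (ln t))) / t \<le> (C + L) * ((t - s) / s) / t"
    using assms by (intro divide_right_mono) auto
  moreover have "G (ln s) / s - G (ln t) / t = (G (ln s) * ((t - s) / s) + (G (ln s) - G (ln t))) / t"
    using assms by (simp add: field_simps)
  ultimately show "G (ln s) / s - G (ln t) / t \<le> (C + L) * (t - s) / (s * t)"
    by simp
qed

text \<open>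
  The values \<open>G (ln n) / n\<close> are prescribed as tail volumes at integers; between integers both the
  tail volume and \<open>G (ln t) / t\<close> are monotone, hence both stay within the same short interval.
\<close>

lemma ex_at_infinity_with:
  fixes G :: "real \<Rightarrow> real"
  assumes lip: "\<And>x y. \<bar>G x - G y\<bar> \<le> L * \<bar>x - y\<bar>"
    and "0 < L" and G_ge: "\<And>x. L \<le> G x" and G_le: "\<And>x. G x \<le> C" and "Q G"
  shows "\<exists>\<Omega> :: (real ^ 'n::finite) set. at_infinity_with Q \<Omega>"
proof -
  define W where "W t = G (ln t) / t" for t
  define K where "K = C + L"
  have G_nonneg: "0 \<le> G \<tau>" for \<tau>
    using G_ge[of \<tau>] \<open>0 < L\<close> by linarith
  have "K > 0"
    using G_ge[of 0] G_le[of 0] \<open>0 < L\<close> by (simp add: K_def)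
  have W_mono: "W t \<le> W s" and W_diff: "W s - W t \<le> K * (t - s) / (s * t)"
    if "0 < s" "s \<le> t" for s t
    using log_rescaled_decay_diff[OF lip G_ge G_le that] \<open>0 < L\<close> by (auto simp: W_def K_def)
  define \<omega> where "\<omega> = unit_ball_vol (real CARD('n))"
  have "\<omega> > 0"
    by (simp add: \<omega>_def)
  \<comment> \<open>From \<open>m\<close> on, the decrements of \<open>W\<close> are at most the volume \<open>\<omega>\<close> of the unit ball, so that they
    fit into the shells; \<open>V\<close> is constant up to \<open>m\<close>, so no volume is placed inside the ball of radius \<open>m\<close>.\<close>
  obtain m :: nat where m: "K / \<omega> < real m"
    using reals_Archimedean2 by blast
  then have "m > 0"
    using \<open>K > 0\<close> \<open>\<omega> > 0\<close> by (cases m) (auto simp: field_simps not_less[symmetric])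
  define V where "V n = W (real (max m n))" for n
  have step: "W (real n) - W (real (Suc n)) \<le> K / real n / real (Suc n)" if "n \<ge> m" for n
    using W_diff[of "real n" "real (Suc n)"] that \<open>m > 0\<close> by (simp add: field_simps)
  have "decseq V"
    unfolding V_def using \<open>m > 0\<close> by (intro decseq_SucI W_mono) auto
  have V_small: "V n - V (Suc n) \<le> unit_ball_vol (real CARD('n))" for n
  proof (cases "n \<ge> m")
    case True
    then have "V n - V (Suc n) \<le> K / real n / real (Suc n)"
      using step by (simp add: V_def max_def)
    also have "\<dots> \<le> K / real n / 1"
      using \<open>K > 0\<close> by (intro divide_left_mono) auto
    also have "\<dots> \<le> K / real m"
      using True \<open>m > 0\<close> \<open>K > 0\<close> by (simp add: frac_le)
    also have "\<dots> \<le> \<omega>"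
      using m \<open>m > 0\<close> \<open>\<omega> > 0\<close> by (simp add: field_simps)
    finally show ?thesis
      by (simp add: \<omega>_def)
  next
    case False
    then have "V n = V (Suc n)"
      by (simp add: V_def max_def Suc_le_eq le_less)
    then show ?thesis
      by simp
  qed
  have "(\<lambda>n. W (real n)) \<longlonglongrightarrow> 0"
  proof (rule tendsto_sandwich)
    show "\<forall>\<^sub>F n in sequentially. 0 \<le> W (real n)"
      using G_nonneg by (intro always_eventually) (simp add: W_def)
    show "\<forall>\<^sub>F n in sequentially. W (real n) \<le> C / real n"
      using G_le by (intro always_eventually) (auto simp: W_def divide_right_mono)
    show "(\<lambda>n. C / real n) \<longlonglongrightarrow> 0"
      by (rule lim_const_over_n)
  qed auto
  then have "V \<longlonglongrightarrow> 0"
    by (rule Lim_transform_eventually)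
      (auto simp: V_def max_def eventually_at_top_linorder intro!: exI[of _ m])
  then obtain \<Omega> :: "(real ^ 'n) set" where \<Omega>: "\<Omega> \<in> lmeasurable"
    "\<And>n. measure lebesgue (tail (real n) \<Omega>) = V n"
    using ex_set_with_tail_volumes[OF \<open>decseq V\<close> _ V_small] by metis
  define r where "r t = t * measure lebesgue (tail t \<Omega>) - G (ln t)" for t
  have r_le: "\<bar>r t\<bar> \<le> K / (t - 1)" if t: "t \<ge> real (Suc m)" for t
  proof -
    define n where "n = nat \<lfloor>t\<rfloor>"
    have n: "real n \<le> t" "t \<le> real (Suc n)" "n \<ge> m" "n > 0"
      using t \<open>m > 0\<close> unfolding n_def by linarith+
    have meas: "tail s \<Omega> \<in> lmeasurable" for s
      unfolding tail_def Int_commute[of "- ball 0 s"]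
      using \<Omega>(1) by (intro fmeasurable_Int_fmeasurable) auto
    have "measure lebesgue (tail t \<Omega>) \<le> measure lebesgue (tail (real n) \<Omega>)"
      using meas n by (intro measure_mono_fmeasurable) (auto simp: tail_def intro: fmeasurableD)
    moreover have "measure lebesgue (tail (real (Suc n)) \<Omega>) \<le> measure lebesgue (tail t \<Omega>)"
      using meas n by (intro measure_mono_fmeasurable) (auto simp: tail_def intro: fmeasurableD)
    ultimately have "measure lebesgue (tail t \<Omega>) \<le> W (real n)"
        "W (real (Suc n)) \<le> measure lebesgue (tail t \<Omega>)"
      using n unfolding \<Omega>(2) by (simp_all add: V_def max_def)
    moreover have "W t \<le> W (real n)" "W (real (Suc n)) \<le> W t"
      using n by (auto intro!: W_mono)
    ultimately have "\<bar>measure lebesgue (tail t \<Omega>) - W t\<bar> \<le> K / real n / real (Suc n)"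
      using step[OF \<open>n \<ge> m\<close>] by linarith
    also have "\<dots> \<le> K / (t - 1) / t"
      using n t \<open>m > 0\<close> \<open>K > 0\<close> by (intro frac_le) auto
    finally have "t * \<bar>measure lebesgue (tail t \<Omega>) - W t\<bar> \<le> t * (K / (t - 1) / t)"
      using t by (intro mult_left_mono) auto
    moreover have "r t = t * (measure lebesgue (tail t \<Omega>) - W t)"
      using t by (simp add: r_def W_def algebra_simps)
    ultimately show ?thesis
      using t by (simp add: abs_mult)
  qed
  have "filterlim (\<lambda>t. -1 + t :: real) at_top at_top"
    by (rule filterlim_tendsto_add_at_top[OF tendsto_const filterlim_ident])
  then have shifted: "filterlim (\<lambda>t. t - 1 :: real) at_top at_top"
    by simp
  have "(r \<longlongrightarrow> 0) at_top"
  proof (rule Lim_null_comparison)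
    show "\<forall>\<^sub>F t in at_top. norm (r t) \<le> K / (t - 1)"
      using eventually_ge_at_top[of "real (Suc m)"] by eventually_elim (use r_le in auto)
    show "((\<lambda>t. K / (t - 1)) \<longlongrightarrow> 0) at_top"
      by (intro tendsto_divide_0[OF tendsto_const] filterlim_at_top_imp_at_infinity shifted)
  qed
  then have "r \<in> o[at_top](\<lambda>_. 1)"
    by (intro smalloI_tendsto) auto
  moreover have "\<forall>\<^sub>F t in at_top. measure lebesgue (tail t \<Omega>) =
      t powr (real CARD('n) + (- real CARD('n) - 1)) * (G (ln t) + r t)"
    using eventually_gt_at_top[of 0]
    by eventually_elim (simp add: r_def powr_minus field_simps)
  moreover have "ereal L \<le> Liminf at_top (\<lambda>\<tau>. ereal (G \<tau>))"
    by (intro Liminf_bounded) (simp add: G_ge)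
  then have "0 < Liminf at_top (\<lambda>\<tau>. ereal (G \<tau>))"
    using \<open>0 < L\<close> by (meson ereal_less(2) less_le_trans)
  moreover have "Limsup at_top (\<lambda>\<tau>. ereal (G \<tau>)) \<le> ereal C"
    by (intro Limsup_bounded) (simp add: G_le)
  then have "Limsup at_top (\<lambda>\<tau>. ereal (G \<tau>)) < \<infinity>"
    by (auto simp: le_less_trans)
  moreover have "Liminf at_top (\<lambda>\<tau>. ereal (G \<tau>)) \<le> Limsup at_top (\<lambda>\<tau>. ereal (G \<tau>))"
    by (intro Liminf_le_Limsup) auto
  ultimately have "at_infinity_with Q \<Omega>"
    unfolding at_infinity_with_def using \<Omega>(1) G_nonneg \<open>Q G\<close>
    by (intro conjI exI[of _ "- real CARD('n) - 1"] exI[of _ G] bexI[of _ r]) auto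
  then show ?thesis
    by blast
qed

section \<open>Infinitely many sets\<close>

lemma at_infinity_with_Un_ball:
  assumes "at_infinity_with Q \<Omega>"
  shows "at_infinity_with Q (\<Omega> \<union> ball 0 s)"
proof -
  have "\<forall>\<^sub>F t in at_top. tail t (\<Omega> \<union> ball 0 s) = tail t \<Omega>"
    using eventually_ge_at_top[of s] by eventually_elim (auto simp: tail_def)
  then have ev: "(\<forall>\<^sub>F t in at_top. measure lebesgue (tail t (\<Omega> \<union> ball 0 s)) = f t) \<longleftrightarrow>
             (\<forall>\<^sub>F t in at_top. measure lebesgue (tail t \<Omega>) = f t)" for f
    by (intro eventually_cong refl) (auto elim: eventually_mono)
  show ?thesis
    using assms unfolding at_infinity_with_def ev by (auto intro: fmeasurable.Un)
qed

text \<open>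
  If the sets \<open>\<Omega> \<union> ball 0 n\<close> were finitely many, their union, the whole space, would have finite
  measure.
\<close>

lemma infinite_at_infinity_with:
  assumes "at_infinity_with Q (\<Omega> :: (real ^ 'n::finite) set)"
  shows "infinite {\<Omega> :: (real ^ 'n) set. at_infinity_with Q \<Omega>}"
proof
  assume fin: "finite {\<Omega> :: (real ^ 'n) set. at_infinity_with Q \<Omega>}"
  define \<Phi> where "\<Phi> n = \<Omega> \<union> ball 0 (real n)" for n
  have \<Phi>: "at_infinity_with Q (\<Phi> n)" for n
    unfolding \<Phi>_def using assms by (rule at_infinity_with_Un_ball)
  then have "finite (range \<Phi>)"
    by (intro finite_subset[OF _ fin]) auto
  then have "(\<Union>n. \<Phi> n) \<in> lmeasurable"
    using \<Phi> by (intro fmeasurable.finite_Union) (auto simp: at_infinity_with_def)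
  moreover have "(\<Union>n. \<Phi> n) = UNIV"
    using reals_Archimedean2 by (fastforce simp: \<Phi>_def)
  ultimately show False
    by (simp add: )
qed

lemma infinite_at_infinity_with_if_quasiperiods:
  assumes "rationally_independent T" "\<And>k. T k \<ge> 1"
    and Q: "\<And>G. has_quasiperiods G T \<Longrightarrow> Q G"
  shows "infinite {\<Omega> :: (real ^ 'n::finite) set. at_infinity_with Q \<Omega>}"
proof -
  define G where "G \<tau> = (4 * pi + 2) + cosine_series T (\<lambda>_. \<tau>)" for \<tau>
  have "T k > 0" for k
    using assms(2)[of k] by linarith
  then have "Q G"
    unfolding G_def using assms(1) by (intro Q has_quasiperiods_cosine_series)
  moreover have "\<bar>G x - G y\<bar> \<le> 4 * pi * \<bar>x - y\<bar>" for x y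
    using cosine_series_diagonal_lipschitz[OF assms(2), where x = x and y = y] by (simp add: G_def)
  moreover have "4 * pi \<le> G x" "G x \<le> 4 * pi + 4" for x
    using abs_cosine_series_le[of T "\<lambda>_. x"] by (simp_all add: G_def abs_le_iff)
  ultimately have "\<exists>\<Omega> :: (real ^ 'n) set. at_infinity_with Q \<Omega>"
    by (intro ex_at_infinity_with[where L = "4 * pi" and G = G]) auto
  then show ?thesis
    using infinite_at_infinity_with by blast
qed

theorem theorem5p11:
  "infinite (algebraically_inf_quasiperiodic_sets :: (real ^ 'n) set set) \<and>
   infinite (transcendentally_inf_quasiperiodic_sets :: (real ^ 'n) set set)"
proof
  obtain T where "\<not> algebraically_independent T" "rationally_independent T" "\<And>k. T k \<ge> 1"
    using ex_rationally_not_algebraically_independent by blast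
  then show "infinite (algebraically_inf_quasiperiodic_sets :: (real ^ 'n) set set)"
    unfolding algebraically_inf_quasiperiodic_sets_def
    by (intro infinite_at_infinity_with_if_quasiperiods[where T = T])
      (auto simp: algebraically_inf_quasiperiodic_def)
next
  obtain T where "algebraically_independent T" "rationally_independent T" "\<And>k. T k \<ge> 1"
    using ex_algebraically_independent by blast
  then show "infinite (transcendentally_inf_quasiperiodic_sets :: (real ^ 'n) set set)"
    unfolding transcendentally_inf_quasiperiodic_sets_def
    by (intro infinite_at_infinity_with_if_quasiperiods[where T = T])
      (auto simp: transcendentally_inf_quasiperiodic_def)
qed

end
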